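(* Let $u\ge \ell\ge 1$ and $m\ge 1$ be integers, let $n\coloneqq 2^\ell$, and let $\mathcal{H}$ be the set of all linear maps $\mathbb{F}_2^u\to\mathbb{F}_2^\ell$. For any $S\subset \mathbb{F}_2^u$ of cardinality $m$ and any real $r\ge 6$, if $h$ is drawn uniformly at random from $\mathcal{H}$, then \[\Pr_{h\sim \mathcal{H}}\left[\max_{y\in \mathbb{F}_2^\ell} |h^{-1}(y)\cap S|\ge r\cdot \textsc{opt}(m,n)\right] \le \frac{49}{(r-2)^2}.\]
   Context: $\log$ denotes the base-2 logarithm. For positive integers $m,n$ define \[\textsc{opt}(m,n) = \begin{cases}\dfrac{\log n}{\log\left(\frac{n\log n}{m}\right)} & m\le \frac{1}{2}n\log n, \\[2mm] \dfrac{m}{n} & m > \frac{1}{2} n\log n.\end{cases}\] *)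

theory Defs
  imports "HOL-Probability.Probability" "HOL-Library.Z2"
begin

instance bit :: finite
proof
  have "(UNIV :: bit set) = {0, 1}"
    by (auto intro: bit.exhaust)
  then show "finite (UNIV :: bit set)"
    by (metis finite.emptyI finite.insertI)
qed

definition opt :: "nat \<Rightarrow> nat \<Rightarrow> real" where
  "opt m n =
    (if real m \<le> 1 / 2 * real n * log 2 (real n)
     then log 2 (real n) / log 2 (real n * log 2 (real n) / real m)
     else real m / real n)"

definition linear_maps :: "(bit ^ 'u \<Rightarrow> bit ^ 'l) set" where
  "linear_maps = {h. Vector_Spaces.linear (*s) (*s) h}"

lemma finite_linear_maps: "finite linear_maps"
  by simp

lemma linear_maps_nonempty: "linear_maps \<noteq> {}"
  using matrix_vector_mul_linear_gen by (auto simp: linear_maps_def)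

definition max_load :: "(bit ^ 'u) set \<Rightarrow> (bit ^ 'u \<Rightarrow> bit ^ 'l) \<Rightarrow> nat" where
  "max_load S h = (MAX y. card (h -` {y} \<inter> S))"

end

theory Submission
  imports Defs
begin

text \<open>
  Let \<open>n\<close> be the number of bins and \<open>q\<close> a power of two between \<open>2 opt\<close> and \<open>4 opt\<close>. Refine the hash \<open>h\<close> by
  \<open>log q\<close> independent random linear functionals, so that every bin \<open>y\<close> splits into \<open>q\<close> cells \<open>(y, Z)\<close>, and
  consider the average over \<open>y\<close> of the product over \<open>Z\<close> of \<open>1 + \<beta> load (y, Z)\<close>.

  Upper bound: adding to \<open>h\<close> a random combination of the functionals leaves its distribution unchanged,
  but shifts the \<open>q\<close> slices against each other. By Jensen the \<open>(2/q)\<close>-th power of the potential then has mean at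
  most the \<open>(2/q)\<close>-th power of the product of the slice averages, hence at most
  \<open>(1 + \<beta> m / (n q))\<^sup>2\<close> by AM-GM.

  Lower bound: a bin with \<open>R = C q\<close> points is spread pairwise independently over its \<open>q\<close> cells. Because
  \<open>ln (1 + \<beta> u) / u\<close> is convex, the logarithm of its product is on average at least
  \<open>q C / (C + 1) ln (1 + \<beta> (C + 1))\<close>. Comparing both bounds for \<open>\<beta> = q n / m\<close> gives the tail.
\<close>

section \<open>Averages of products of shifted functions\<close>

text \<open>Weighted AM-GM: each \<open>x j\<close> has weight \<open>s\<close>, and the leftover
  weight \<open>1 - s * card J\<close> sits on the value 1. With \<open>p\<close> the weighted mean,
  the tangent bound \<open>ln z <= z - 1\<close> is summed at \<open>x j / p\<close> and
  \<open>1 / p\<close>.\<close>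

lemma weighted_prod_powr_le:
  fixes x :: "'j \<Rightarrow> real" and s :: real
  assumes J: "finite J" and s: "0 \<le> s" "s * card J \<le> 1" and pos: "\<And>j. j \<in> J \<Longrightarrow> x j > 0"
  shows "(\<Prod>j\<in>J. x j powr s) \<le> s * (\<Sum>j\<in>J. x j) + (1 - s * card J)"
proof -
  define p where "p = s * (\<Sum>j\<in>J. x j) + (1 - s * card J)"
  have sum0: "(\<Sum>j\<in>J. x j) \<ge> 0"
    using pos by (simp add: sum_nonneg less_imp_le)
  have p: "p > 0"
  proof (cases "s * card J = 1")
    case True
    then have "J \<noteq> {}" "s > 0" using s(1) by (auto simp: less_le)
    then have "(\<Sum>j\<in>J. x j) > 0" using J pos by (simp add: sum_pos)
    then show ?thesis using True \<open>s > 0\<close> by (simp add: p_def)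
  next
    case False
    then show ?thesis using s sum0 by (simp add: p_def add_nonneg_pos)
  qed
  have "(\<Sum>j\<in>J. s * ln (x j / p)) \<le> (\<Sum>j\<in>J. s * (x j / p - 1))"
    using pos p s(1) by (intro sum_mono mult_left_mono ln_le_minus_one) auto
  also have "\<dots> = (p - 1 + s * card J) / p - s * card J"
    by (simp add: p_def sum_subtractf sum_divide_distrib [symmetric] sum_distrib_left [symmetric]
        right_diff_distrib algebra_simps)
  finally have 1: "(\<Sum>j\<in>J. s * ln (x j / p)) \<le> (p - 1 + s * card J) / p - s * card J" .
  have 2: "(1 - s * card J) * ln (1 / p) \<le> (1 - s * card J) * (1 / p - 1)"
    using s(2) p by (intro mult_left_mono ln_le_minus_one) auto
  have "(\<Sum>j\<in>J. s * ln (x j / p)) = (\<Sum>j\<in>J. s * ln (x j)) - s * card J * ln p"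
    using pos p by (simp add: ln_div sum_subtractf right_diff_distrib less_imp_neq[symmetric] cong: sum.cong)
  then have "(\<Sum>j\<in>J. s * ln (x j)) - ln p
      = (\<Sum>j\<in>J. s * ln (x j / p)) + (1 - s * card J) * ln (1 / p)"
    using p by (simp add: ln_div algebra_simps)
  also have "\<dots> \<le> 0"
    using add_mono [OF 1 2] p by (simp add: field_simps)
  finally have "exp (\<Sum>j\<in>J. s * ln (x j)) \<le> p"
    using p by (simp add: ln_ge_iff)
  moreover have "(\<Prod>j\<in>J. x j powr s) = exp (\<Sum>j\<in>J. s * ln (x j))"
    using J pos by (simp add: exp_sum powr_def less_imp_neq[symmetric] cong: prod.cong)
  ultimately show ?thesis by (simp add: p_def)
qed

text \<open>Hoelder's inequality: once every \<open>X j\<close> is divided by its mean, the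
  pointwise AM-GM bound averages to exactly 1, whatever weight is left over.\<close>

lemma avg_prod_powr_le:
  fixes X :: "'j \<Rightarrow> 'w \<Rightarrow> real" and s :: real
  assumes J: "finite J" and s: "0 \<le> s" "s * card J \<le> 1"
    and W: "finite W" "W \<noteq> {}" and pos: "\<And>j w. j \<in> J \<Longrightarrow> w \<in> W \<Longrightarrow> X j w > 0"
  shows "(\<Sum>w\<in>W. \<Prod>j\<in>J. X j w powr s) / card W \<le> (\<Prod>j\<in>J. ((\<Sum>w\<in>W. X j w) / card W) powr s)"
proof -
  define \<mu> where "\<mu> j = (\<Sum>w\<in>W. X j w) / card W" for j
  have cW: "real (card W) > 0" using W by (simp add: card_gt_0_iff)
  have \<mu>: "\<mu> j > 0" if "j \<in> J" for j
    using that W pos cW by (simp add: \<mu>_def sum_pos)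
  have norm: "(\<Sum>w\<in>W. X j w / \<mu> j) = card W" if "j \<in> J" for j
    proof -
    have "(\<Sum>w\<in>W. X j w) = card W * \<mu> j" using cW by (simp add: \<mu>_def)
    then show ?thesis using \<mu>[OF that] by (simp flip: sum_divide_distrib)
  qed
  have "(\<Sum>w\<in>W. \<Prod>j\<in>J. (X j w / \<mu> j) powr s)
      \<le> (\<Sum>w\<in>W. s * (\<Sum>j\<in>J. X j w / \<mu> j) + (1 - s * card J))"
    using J s pos \<mu> by (intro sum_mono weighted_prod_powr_le) auto
  also have "\<dots> = s * (\<Sum>j\<in>J. \<Sum>w\<in>W. X j w / \<mu> j) + card W * (1 - s * card J)"
    by (subst sum.swap) (simp add: sum.distrib sum_distrib_left)
  also have "\<dots> = card W"
    by (simp add: norm algebra_simps)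
  finally have le: "(\<Sum>w\<in>W. \<Prod>j\<in>J. (X j w / \<mu> j) powr s) \<le> card W" .
  have "(\<Sum>w\<in>W. \<Prod>j\<in>J. X j w powr s)
      = (\<Prod>j\<in>J. \<mu> j powr s) * (\<Sum>w\<in>W. \<Prod>j\<in>J. (X j w / \<mu> j) powr s)"
    unfolding sum_distrib_left prod.distrib [symmetric]
    using \<mu> pos by (intro sum.cong prod.cong refl) (simp add: powr_mult [symmetric] less_imp_le less_imp_neq[symmetric])
  also have "\<dots> \<le> (\<Prod>j\<in>J. \<mu> j powr s) * card W"
    using le by (intro mult_left_mono prod_nonneg) auto
  finally show ?thesis
    using cW by (simp add: \<mu>_def divide_le_eq)
qed

lemma sum_PiE_insert:
  assumes "i \<notin> I"
  shows "(\<Sum>w\<in>insert i I \<rightarrow>\<^sub>E A. f w) = (\<Sum>c\<in>A. \<Sum>w\<in>I \<rightarrow>\<^sub>E A. f (w(i := c)))"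
proof -
  have "(\<Sum>w\<in>insert i I \<rightarrow>\<^sub>E A. f w) = (\<Sum>(c, w)\<in>A \<times> (I \<rightarrow>\<^sub>E A). f (w(i := c)))"
    unfolding PiE_insert_eq
    by (subst sum.reindex) (use inj_combinator[OF assms, of "\<lambda>_. A"] in \<open>auto simp: case_prod_beta o_def\<close>)
  then show ?thesis by (simp add: sum.cartesian_product)
qed

lemma prod_Pow_insert:
  assumes "finite I" "i \<notin> I"
  shows "(\<Prod>Z\<in>Pow (insert i I). f Z) = (\<Prod>Z\<in>Pow I. f Z * f (insert i Z))"
proof -
  have "inj_on (insert i) (Pow I)"
    using assms(2) by (auto simp: inj_on_def)
  moreover have "Pow I \<inter> insert i ` Pow I = {}"
    using assms(2) by auto
  ultimately show ?thesis
    using assms(1) by (simp add: Pow_insert prod.union_disjoint prod.reindex prod.distrib)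
qed

text \<open>
  Fixing the shift \<open>w i\<close> merges the functions of \<open>Z\<close> and \<open>insert i Z\<close>; after averaging over \<open>w i\<close> their
  means multiply, at the price of a Hoelder inequality with \<open>2 ^ (card I - 1)\<close> factors. This is why
  the exponent may be as large as \<open>2 / 2 ^ card I\<close>, which is the source of the quadratic tail.
\<close>

lemma avg_shifted_prod_powr_le:
  fixes g :: "'i set \<Rightarrow> 'y::{finite,ab_group_add} \<Rightarrow> real"
  assumes "finite I" "\<And>Z y. g Z y > 0" "0 \<le> s" "s * 2 ^ card I \<le> 2"
  shows "(\<Sum>w\<in>I \<rightarrow>\<^sub>E UNIV. ((\<Sum>y\<in>UNIV. \<Prod>Z\<in>Pow I. g Z (y + (\<Sum>i\<in>Z. w i))) / CARD('y)) powr s) / real CARD('y) ^ card I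
       \<le> (\<Prod>Z\<in>Pow I. ((\<Sum>y\<in>UNIV. g Z y) / CARD('y)) powr s)"
  using assms(1,2,4)
proof (induction I arbitrary: g rule: finite_induct)
  case empty
  then show ?case by simp
next
  case (insert i I)
  let ?N = "real CARD('y)"
  \<comment> \<open>For \<open>c = w i\<close>, the remaining shifts move the slices
    \<open>Z\<close> and \<open>insert i Z\<close> by the same amount, so the pair behaves as one
    slice.\<close>
  define g' where "g' c Z y = g Z y * g (insert i Z) (y + c)" for c Z y
  have g': "g' c Z y > 0" for c Z y
    using insert.prems(1) by (simp add: g'_def)
  have s2: "s * 2 ^ card I \<le> 1"
    using insert.prems(2) insert.hyps by simp
  have "(\<Prod>Z\<in>Pow (insert i I). g Z (y + (\<Sum>k\<in>Z. (w(i := c)) k)))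
      = (\<Prod>Z\<in>Pow I. g' c Z (y + (\<Sum>k\<in>Z. w k)))" for c w y
  proof -
    have "(\<Sum>k\<in>Z. (w(i := c)) k) = (\<Sum>k\<in>Z. w k)"
      and "(\<Sum>k\<in>insert i Z. (w(i := c)) k) = c + (\<Sum>k\<in>Z. w k)" if "Z \<in> Pow I" for Z
    proof -
      have Z: "i \<notin> Z" "finite Z" using that insert.hyps by (auto intro: finite_subset)
      show *: "(\<Sum>k\<in>Z. (w(i := c)) k) = (\<Sum>k\<in>Z. w k)"
        using Z by (intro sum.cong) auto
      show "(\<Sum>k\<in>insert i Z. (w(i := c)) k) = c + (\<Sum>k\<in>Z. w k)"
        using Z * by (simp del: fun_upd_apply) simp
    qed
    then show ?thesis
      using insert.hyps by (subst prod_Pow_insert) (auto simp: g'_def ac_simps simp del: fun_upd_apply intro!: prod.cong)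
  qed
  then have "(\<Sum>w\<in>insert i I \<rightarrow>\<^sub>E UNIV. ((\<Sum>y\<in>UNIV. \<Prod>Z\<in>Pow (insert i I). g Z (y + (\<Sum>i\<in>Z. w i))) / ?N) powr s) / ?N ^ card (insert i I)
      = (\<Sum>c\<in>UNIV. (\<Sum>w\<in>I \<rightarrow>\<^sub>E UNIV. ((\<Sum>y\<in>UNIV. \<Prod>Z\<in>Pow I. g' c Z (y + (\<Sum>i\<in>Z. w i))) / ?N) powr s) / ?N ^ card I) / ?N"
    using insert.hyps by (subst sum_PiE_insert) (simp_all add: sum_divide_distrib [symmetric] field_simps del: fun_upd_apply)
  also have "\<dots> \<le> (\<Sum>c\<in>UNIV. \<Prod>Z\<in>Pow I. ((\<Sum>y\<in>UNIV. g' c Z y) / ?N) powr s) / ?N"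
  proof (intro divide_right_mono sum_mono)
    fix c
    show "(\<Sum>w\<in>I \<rightarrow>\<^sub>E UNIV. ((\<Sum>y\<in>UNIV. \<Prod>Z\<in>Pow I. g' c Z (y + (\<Sum>i\<in>Z. w i))) / ?N) powr s) / ?N ^ card I
       \<le> (\<Prod>Z\<in>Pow I. ((\<Sum>y\<in>UNIV. g' c Z y) / ?N) powr s)"
      using s2 g' by (intro insert.IH) auto
  qed simp
  also have "\<dots> \<le> (\<Prod>Z\<in>Pow I. ((\<Sum>c\<in>UNIV. (\<Sum>y\<in>UNIV. g' c Z y) / ?N) / ?N) powr s)"
    using avg_prod_powr_le[of "Pow I" s UNIV "\<lambda>Z c. (\<Sum>y\<in>UNIV. g' c Z y) / ?N"]
      insert.hyps s2 \<open>0 \<le> s\<close> g' by (simp add: card_Pow sum_pos)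
  also have "\<dots> = (\<Prod>Z\<in>Pow I. ((\<Sum>y\<in>UNIV. g Z y) / ?N) powr s * ((\<Sum>y\<in>UNIV. g (insert i Z) y) / ?N) powr s)"
  proof (intro prod.cong refl)
    fix Z
    \<comment> \<open>For fixed \<open>y\<close> the point \<open>y + c\<close> runs uniformly over
      the group, so averaging over \<open>c\<close> decouples the two factors of
      \<open>g'\<close>.\<close>
    have shift: "(\<Sum>c\<in>UNIV. g (insert i Z) (y + c)) = (\<Sum>c\<in>UNIV. g (insert i Z) c)" for y
      by (rule sum.reindex_bij_witness[of _ "\<lambda>c. c - y" "\<lambda>c. y + c"]) auto
    have "(\<Sum>c\<in>UNIV. \<Sum>y\<in>UNIV. g' c Z y) = (\<Sum>y\<in>UNIV. g Z y * (\<Sum>c\<in>UNIV. g (insert i Z) c))"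
      unfolding g'_def by (subst sum.swap) (simp add: shift flip: sum_distrib_left)
    then have "(\<Sum>c\<in>UNIV. (\<Sum>y\<in>UNIV. g' c Z y) / ?N) / ?N
        = ((\<Sum>y\<in>UNIV. g Z y) / ?N) * ((\<Sum>y\<in>UNIV. g (insert i Z) y) / ?N)"
      by (simp add: sum_distrib_right sum_divide_distrib [symmetric])
    then show "((\<Sum>c\<in>UNIV. (\<Sum>y\<in>UNIV. g' c Z y) / ?N) / ?N) powr s
        = ((\<Sum>y\<in>UNIV. g Z y) / ?N) powr s * ((\<Sum>y\<in>UNIV. g (insert i Z) y) / ?N) powr s"
      by (simp only: powr_mult)
  qed
  also have "\<dots> = (\<Prod>Z\<in>Pow (insert i I). ((\<Sum>y\<in>UNIV. g Z y) / ?N) powr s)"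
    using insert.hyps by (simp add: prod_Pow_insert)
  finally show ?case .
qed

section \<open>Jensen and the function \<open>ln (1 + \<beta> * u) / u\<close>\<close>

lemma convex_on_avg:
  fixes f :: "real \<Rightarrow> real"
  assumes "convex_on C f" "finite S" "S \<noteq> {}" "\<And>i. i \<in> S \<Longrightarrow> y i \<in> C"
  shows "f ((\<Sum>i\<in>S. y i) / card S) \<le> (\<Sum>i\<in>S. f (y i)) / card S"
  using convex_on_sum[of S C f "\<lambda>_. 1 / card S" y] assms
  by (simp add: sum_divide_distrib)

text \<open>With \<open>z = x / (1 + x)\<close> one has \<open>ln (1 + x) = - ln (1 - z)\<close>,
  and the left side consists of the first two terms of its power series in \<open>z\<close>. One
  term yields monotonicity below, two terms yield convexity.\<close>

lemma ln_one_plus_lower: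
  fixes x :: real
  assumes "x \<ge> 0"
  shows "x / (1 + x) + (x / (1 + x))\<^sup>2 / 2 \<le> ln (1 + x)"
proof -
  define f where "f x = ln (1 + x) - x / (1 + x) - (x / (1 + x))\<^sup>2 / 2" for x :: real
  have "f 0 \<le> f x"
  proof (rule DERIV_nonneg_imp_nondecreasing[OF assms], intro exI conjI)
    fix t :: real
    assume "0 \<le> t"
    have ne: "1 + t \<noteq> 0" using \<open>0 \<le> t\<close> by simp
    have "(f has_real_derivative
        1 / (1 + t) - (1 * (1 + t) - t * 1) / ((1 + t) * (1 + t))
        - (2 * (t / (1 + t)) * ((1 * (1 + t) - t * 1) / ((1 + t) * (1 + t)))) / 2) (at t)"
      unfolding f_def using \<open>0 \<le> t\<close>
      by (auto intro!: derivative_eq_intros)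
    moreover have "1 / (1 + t) - (1 * (1 + t) - t * 1) / ((1 + t) * (1 + t))
        - (2 * (t / (1 + t)) * ((1 * (1 + t) - t * 1) / ((1 + t) * (1 + t)))) / 2 = t\<^sup>2 / (1 + t) ^ 3"
      using ne by (simp add: divide_simps power2_eq_square power3_eq_cube) (simp add: algebra_simps)
    ultimately show "(f has_real_derivative t\<^sup>2 / (1 + t) ^ 3) (at t)" by simp
    show "t\<^sup>2 / (1 + t) ^ 3 \<ge> 0" using \<open>0 \<le> t\<close> by simp
  qed
  then show ?thesis by (simp add: f_def)
qed

lemma ln_one_plus_div_deriv:
  fixes \<beta> u :: real
  assumes "\<beta> > 0" "u > 0"
  shows "((\<lambda>u. ln (1 + \<beta> * u) / u) has_real_derivative
           \<beta> / (u * (1 + \<beta> * u)) - ln (1 + \<beta> * u) / u\<^sup>2) (at u)"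
proof -
  have "1 + \<beta> * u > 0" using assms by (simp add: add_pos_pos)
  then have "((\<lambda>u. ln (1 + \<beta> * u) / u) has_real_derivative
      (\<beta> / (1 + \<beta> * u) * u - ln (1 + \<beta> * u) * 1) / (u * u)) (at u)"
    using assms by (auto intro!: derivative_eq_intros)
  moreover have "(\<beta> / (1 + \<beta> * u) * u - ln (1 + \<beta> * u) * 1) / (u * u)
      = \<beta> / (u * (1 + \<beta> * u)) - ln (1 + \<beta> * u) / u\<^sup>2"
    using assms \<open>1 + \<beta> * u > 0\<close> by (simp add: diff_divide_distrib power2_eq_square)
  ultimately show ?thesis by simp
qed

lemma ln_one_plus_div_antimono:
  fixes \<beta> u v :: real
  assumes "\<beta> > 0" "u > 0" "u \<le> v"
  shows "ln (1 + \<beta> * v) / v \<le> ln (1 + \<beta> * u) / u"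
proof (rule DERIV_nonpos_imp_nonincreasing[OF assms(3)], intro exI conjI)
  fix t assume "u \<le> t"
  then have t: "t > 0" using assms by simp
  have pos: "1 + \<beta> * t > 0" using assms t by (simp add: add_pos_pos)
  show "((\<lambda>u. ln (1 + \<beta> * u) / u) has_real_derivative
           \<beta> / (t * (1 + \<beta> * t)) - ln (1 + \<beta> * t) / t\<^sup>2) (at t)"
    using ln_one_plus_div_deriv assms t by blast
  have "\<beta> * t / (1 + \<beta> * t) \<le> ln (1 + \<beta> * t)"
    using ln_one_plus_lower[of "\<beta> * t"] assms t
    by (smt (verit) mult_nonneg_nonneg divide_nonneg_nonneg zero_le_power2)
  then have "\<beta> * t / (1 + \<beta> * t) / t\<^sup>2 \<le> ln (1 + \<beta> * t) / t\<^sup>2"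
    by (intro divide_right_mono) auto
  then show "\<beta> / (t * (1 + \<beta> * t)) - ln (1 + \<beta> * t) / t\<^sup>2 \<le> 0"
    using t by (simp add: power2_eq_square mult.commute)
qed

text \<open>The second derivative is \<open>2 * (ln (1 + \<beta> * u) - z - z^2 / 2) / u ^ 3\<close>
  with \<open>z = \<beta> * u / (1 + \<beta> * u)\<close>, so its sign is the two-term bound on the
  logarithm.\<close>

lemma ln_one_plus_div_convex:
  fixes \<beta> :: real
  assumes "\<beta> > 0"
  shows "convex_on {0<..} (\<lambda>u. ln (1 + \<beta> * u) / u)"
proof (rule f''_ge0_imp_convex)
  have identity: "- (\<beta> * (1 * p + \<beta> * u)) / ((u * p) * (u * p)) - (\<beta> / p * u\<^sup>2 - L * (2 * u)) / (u\<^sup>2 * u\<^sup>2)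
      = 2 * (L - \<beta> * u / p - (\<beta> * u / p)\<^sup>2 / 2) / u ^ 3" if "u > 0" "p > 0" for u p L :: real
  proof -
    have "- (\<beta> * (1 * p + \<beta> * u)) / ((u * p) * (u * p)) = - \<beta> / (p * u\<^sup>2) - \<beta>\<^sup>2 / (u * p\<^sup>2)"
      using that by (simp add: field_simps power2_eq_square)
    moreover have "(\<beta> / p * u\<^sup>2 - L * (2 * u)) / (u\<^sup>2 * u\<^sup>2) = \<beta> / (p * u\<^sup>2) - 2 * L / u ^ 3"
      using that by (simp add: field_simps power2_eq_square power3_eq_cube)
    moreover have "2 * (L - \<beta> * u / p - (\<beta> * u / p)\<^sup>2 / 2) / u ^ 3
        = 2 * L / u ^ 3 - 2 * \<beta> / (p * u\<^sup>2) - \<beta>\<^sup>2 / (u * p\<^sup>2)"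
      using that by (simp add: field_simps power2_eq_square power3_eq_cube)
    ultimately show ?thesis by simp
  qed
  fix u :: real
  assume "u \<in> {0<..}"
  then have u: "u > 0" by simp
  have pos: "1 + \<beta> * u > 0" using assms u by (simp add: add_pos_pos)
  show "((\<lambda>u. ln (1 + \<beta> * u) / u) has_real_derivative
           \<beta> / (u * (1 + \<beta> * u)) - ln (1 + \<beta> * u) / u\<^sup>2) (at u)"
    using ln_one_plus_div_deriv assms u by blast
  let ?z = "\<beta> * u / (1 + \<beta> * u)"
  have "((\<lambda>u. \<beta> / (u * (1 + \<beta> * u)) - ln (1 + \<beta> * u) / u\<^sup>2) has_real_derivative
      - (\<beta> * (1 * (1 + \<beta> * u) + \<beta> * u)) / ((u * (1 + \<beta> * u)) * (u * (1 + \<beta> * u)))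
      - (\<beta> / (1 + \<beta> * u) * u\<^sup>2 - ln (1 + \<beta> * u) * (2 * u)) / (u\<^sup>2 * u\<^sup>2)) (at u)"
    using u pos by (auto intro!: derivative_eq_intros)
  moreover have "- (\<beta> * (1 * (1 + \<beta> * u) + \<beta> * u)) / ((u * (1 + \<beta> * u)) * (u * (1 + \<beta> * u)))
      - (\<beta> / (1 + \<beta> * u) * u\<^sup>2 - ln (1 + \<beta> * u) * (2 * u)) / (u\<^sup>2 * u\<^sup>2)
      = 2 * (ln (1 + \<beta> * u) - ?z - ?z\<^sup>2 / 2) / u ^ 3"
    using identity u pos by blast
  ultimately show "((\<lambda>u. \<beta> / (u * (1 + \<beta> * u)) - ln (1 + \<beta> * u) / u\<^sup>2) has_real_derivative
      2 * (ln (1 + \<beta> * u) - ?z - ?z\<^sup>2 / 2) / u ^ 3) (at u)" by simp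
  show "2 * (ln (1 + \<beta> * u) - ?z - ?z\<^sup>2 / 2) / u ^ 3 \<ge> 0"
    using ln_one_plus_lower[of "\<beta> * u"] assms u by simp
qed auto

section \<open>Pairwise independence of random linear functionals\<close>

definition dot :: "bit ^ 'u \<Rightarrow> bit ^ 'u \<Rightarrow> bit" where
  "dot a x = (\<Sum>k\<in>UNIV. a $ k * x $ k)"

lemma dot_add_left: "dot (a + b) x = dot a x + dot b x"
  by (simp only: dot_def vector_add_component distrib_right sum.distrib)

lemma dot_diff_left: "dot (a - b) x = dot a x - dot b x"
  by (simp only: dot_def vector_minus_component left_diff_distrib sum_subtractf)

lemma dot_add_right: "dot a (x + y) = dot a x + dot a y"
  by (simp only: dot_def vector_add_component distrib_left sum.distrib)

lemma dot_diff_right: "dot a (x - y) = dot a x - dot a y"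
  by (simp only: dot_def vector_minus_component right_diff_distrib sum_subtractf)

lemma dot_scale_right: "dot a (c *s x) = c * dot a x"
  by (simp only: dot_def vector_smult_component sum_distrib_left mult.left_commute)

lemma dot_axis: "dot (axis k 1) x = x $ k"
proof -
  have "dot (axis k 1) x = (\<Sum>k'\<in>UNIV. if k' = k then x $ k' else 0)"
    unfolding dot_def by (rule sum.cong) (auto simp: axis_def)
  then show ?thesis by (simp only: sum.delta finite_UNIV UNIV_I if_True finite)
qed

text \<open>Adding a basis vector at a coordinate where \<open>d\<close> is 1 flips the value of
  \<open>dot a d\<close>, which matches the two fibres.\<close>

lemma card_dot_eq_0:
  fixes d :: "bit ^ 'u"
  assumes "d \<noteq> 0"
  shows "2 * card {a. dot a d = 0} = CARD(bit ^ 'u)"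
proof -
  obtain k where k: "d $ k = 1"
    using assms by (auto simp: vec_eq_iff)
  have "bij_betw (\<lambda>a. a + axis k 1) {a. dot a d = 0} {a. dot a d = 1}"
    by (rule bij_betw_byWitness[where f' = "\<lambda>a. a - axis k 1"])
      (auto simp: dot_add_left dot_diff_left dot_axis k)
  then have "card {a. dot a d = 0} = card {a. dot a d = 1}"
    by (rule bij_betw_same_card)
  moreover have "(UNIV :: (bit ^ 'u) set) = {a. dot a d = 0} \<union> {a. dot a d = 1}"
    by (auto)
  then have "CARD(bit ^ 'u) = card {a. dot a d = 0} + card {a. dot a d = 1}"
    by (subst card_Un_disjoint [symmetric]) auto
  ultimately show ?thesis by simp
qed

text \<open>
  Vectors \<open>a i\<close> encode linear functionals, and a point is labelled by the set of functionals in
  \<open>I\<close> taking the value 1 on it. Uniform \<open>a\<close> makes this a pairwise independent hash into the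
  \<open>2 ^ card I\<close> subsets of \<open>I\<close>.
\<close>

definition pattern :: "'i set \<Rightarrow> ('i \<Rightarrow> bit ^ 'u) \<Rightarrow> bit ^ 'u \<Rightarrow> 'i set" where
  "pattern I a x = {i \<in> I. dot (a i) x = 1}"

lemma pattern_in_Pow: "pattern I a x \<in> Pow I"
  by (auto simp: pattern_def)

text \<open>Two points share a label iff every functional vanishes on their difference, and each of
  the \<open>card I\<close> independent functionals does so with probability one half.\<close>

lemma card_pattern_eq:
  fixes x x' :: "bit ^ 'u"
  assumes "finite I" "x \<noteq> x'"
  shows "2 ^ card I * card {a \<in> I \<rightarrow>\<^sub>E UNIV. pattern I a x = pattern I a x'} = CARD(bit ^ 'u) ^ card I"
proof -
  have "{a \<in> I \<rightarrow>\<^sub>E UNIV. pattern I a x = pattern I a x'} = I \<rightarrow>\<^sub>E {c. dot c (x - x') = 0}"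
  proof -
    have "pattern I a x = pattern I a x' \<longleftrightarrow> (\<forall>i\<in>I. dot (a i) x = dot (a i) x')" for a
      unfolding pattern_def set_eq_iff by (smt (verit) mem_Collect_eq bit_not_one_iff)
    moreover have "dot c (x - x') = 0 \<longleftrightarrow> dot c x = dot c x'" for c
      by (simp only: dot_diff_right right_minus_eq)
    ultimately show ?thesis
      unfolding set_eq_iff mem_Collect_eq PiE_iff by blast
  qed
  then have "2 ^ card I * card {a \<in> I \<rightarrow>\<^sub>E UNIV. pattern I a x = pattern I a x'}
      = (2 * card {c. dot c (x - x') = 0}) ^ card I"
    using assms(1) by (simp add: card_PiE power_mult_distrib)
  then show ?thesis using assms(2) by (simp add: card_dot_eq_0)
qed

text \<open>The double sum over points counts colliding ordered pairs: pairs with equal entries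
  always collide, the others for a fraction \<open>1 / 2 ^ card I\<close> of all
  \<open>a\<close>.\<close>

lemma sum_card_pattern:
  fixes T :: "(bit ^ 'u) set"
  assumes "finite I"
  shows "(\<Sum>a\<in>I \<rightarrow>\<^sub>E UNIV. \<Sum>x\<in>T. card {x' \<in> T. pattern I a x' = pattern I a x}) * 2 ^ card I
     \<le> CARD(bit ^ 'u) ^ card I * (card T * (2 ^ card I + card T))"
proof -
  let ?B = "I \<rightarrow>\<^sub>E (UNIV :: (bit ^ 'u) set)"
  have cB: "card ?B = CARD(bit ^ 'u) ^ card I" using assms by (simp add: card_PiE)
  have finB: "finite ?B" using assms by (simp add: finite_PiE)
  have "(\<Sum>a\<in>?B. \<Sum>x\<in>T. card {x' \<in> T. pattern I a x' = pattern I a x})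
      = (\<Sum>a\<in>?B. \<Sum>x\<in>T. \<Sum>x'\<in>T. of_bool (pattern I a x' = pattern I a x))"
    by (simp add: of_bool_def sum.If_cases Int_def)
  also have "\<dots> = (\<Sum>x\<in>T. \<Sum>x'\<in>T. \<Sum>a\<in>?B. of_bool (pattern I a x' = pattern I a x))"
    by (subst sum.swap, rule sum.cong[OF refl], rule sum.swap)
  also have "\<dots> = (\<Sum>x\<in>T. \<Sum>x'\<in>T. card {a \<in> ?B. pattern I a x' = pattern I a x})"
    using finB by (simp add: of_bool_def sum.If_cases Int_def)
  finally have "(\<Sum>a\<in>?B. \<Sum>x\<in>T. card {x' \<in> T. pattern I a x' = pattern I a x}) * 2 ^ card I
      = (\<Sum>x\<in>T. \<Sum>x'\<in>T. 2 ^ card I * card {a \<in> ?B. pattern I a x' = pattern I a x})"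
    by (simp add: sum_distrib_left mult.commute)
  \<comment> \<open>Diagonal pairs are charged \<open>2 ^ card I + 1\<close> instead of
    \<open>2 ^ card I\<close>, which keeps the closed form free of a \<open>- 1\<close>.\<close>
  also have "\<dots> \<le> (\<Sum>x\<in>T. \<Sum>x'\<in>T. card ?B * (1 + (if x' = x then 2 ^ card I else 0)))"
  proof (intro sum_mono)
    fix x x' :: "bit ^ 'u"
    show "2 ^ card I * card {a \<in> ?B. pattern I a x' = pattern I a x} \<le> card ?B * (1 + (if x' = x then 2 ^ card I else 0))"
      using card_pattern_eq[of I x' x] assms cB by auto
  qed
  also have "\<dots> = card ?B * (card T * (2 ^ card I + card T))"
    by (simp add: sum.distrib flip: sum_distrib_left) (simp add: algebra_simps)
  finally show ?thesis by (simp add: cB)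
qed

text \<open>A cell with \<open>k > 0\<close> points contributes
  \<open>ln (1 + \<beta> * k) = k * \<psi> k\<close>, that is \<open>\<psi> k\<close> for each of
  its points, so the logarithm of the product becomes a sum over points. Jensen enters twice: for
  the convex decreasing \<open>\<psi>\<close>, to replace the load by \<open>D\<close>, and for
  \<open>exp\<close>, to return from logarithms to powers.\<close>

lemma avg_pattern_prod_powr_ge:
  fixes T :: "(bit ^ 'u) set" and \<beta> s D :: real
  assumes I: "finite I" and T: "T \<noteq> {}" and \<beta>: "\<beta> > 0" and s: "s \<ge> 0"
    and D: "D = 1 + card T / 2 ^ card I"
  shows "(1 + \<beta> * D) powr (s * card T / D)
    \<le> (\<Sum>a\<in>I \<rightarrow>\<^sub>E UNIV. (\<Prod>Z\<in>Pow I. 1 + \<beta> * card {x \<in> T. pattern I a x = Z}) powr s)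
       / real CARD(bit ^ 'u) ^ card I"
proof -
  let ?B = "I \<rightarrow>\<^sub>E (UNIV :: (bit ^ 'u) set)"
  define \<psi> where "\<psi> u = ln (1 + \<beta> * u) / u" for u
  define X where "X a x = real (card {x' \<in> T. pattern I a x' = pattern I a x})" for a x
  have cB: "real (card ?B) = real CARD(bit ^ 'u) ^ card I" using I by (simp add: card_PiE)
  have finB: "finite ?B" using I by (simp add: finite_PiE)
  have Bne: "?B \<noteq> {}" by (simp add: PiE_eq_empty_iff)
  have cBpos: "real (card ?B) > 0" using finB Bne by (simp add: card_gt_0_iff)
  have cT: "real (card T) > 0" using T by (simp add: card_gt_0_iff)
  have Dpos: "D > 0" using D by (simp add: add_pos_nonneg)
  have Xpos: "X a x > 0" if "x \<in> T" for a x
    using that by (auto simp: X_def card_gt_0_iff)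
  have logprod: "(\<Prod>Z\<in>Pow I. 1 + \<beta> * card {x \<in> T. pattern I a x = Z}) powr s
      = exp (s * (\<Sum>x\<in>T. \<psi> (X a x)))" for a
  proof -
    have pos: "1 + \<beta> * real k > 0" for k using \<beta> by (simp add: add_pos_nonneg)
    have "(\<Sum>x\<in>T. \<psi> (X a x)) = (\<Sum>Z\<in>Pow I. \<Sum>x\<in>{x \<in> T. pattern I a x = Z}. \<psi> (X a x))"
      using I by (intro sum.group [symmetric] image_subsetI pattern_in_Pow) auto
    also have "\<dots> = (\<Sum>Z\<in>Pow I. ln (1 + \<beta> * card {x \<in> T. pattern I a x = Z}))"
    proof (intro sum.cong refl)
      fix Z
      have "(\<Sum>x\<in>{x \<in> T. pattern I a x = Z}. \<psi> (X a x))
          = (\<Sum>x\<in>{x \<in> T. pattern I a x = Z}. \<psi> (card {x \<in> T. pattern I a x = Z}))"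
        by (intro sum.cong refl) (auto simp: X_def)
      also have "\<dots> = card {x \<in> T. pattern I a x = Z} * \<psi> (card {x \<in> T. pattern I a x = Z})"
        by (rule sum_constant)
      also have "\<dots> = ln (1 + \<beta> * card {x \<in> T. pattern I a x = Z})"
        by (cases "card {x \<in> T. pattern I a x = Z} = 0") (simp_all only: \<psi>_def, simp_all)
      finally show "(\<Sum>x\<in>{x \<in> T. pattern I a x = Z}. \<psi> (X a x)) = ln (1 + \<beta> * card {x \<in> T. pattern I a x = Z})" .
    qed
    also have "\<dots> = ln (\<Prod>Z\<in>Pow I. 1 + \<beta> * card {x \<in> T. pattern I a x = Z})"
      using I pos by (subst ln_prod) (auto simp: less_imp_neq[symmetric])
    finally show ?thesis
      using pos by (simp add: powr_def prod_zero_iff I less_imp_neq[symmetric])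
  qed
  \<comment> \<open>Summing over points of \<open>T\<close> instead of labels is a size-biased average, whose mean load is at most \<open>D\<close>.\<close>
  have "card T * \<psi> D \<le> (\<Sum>a\<in>?B. \<Sum>x\<in>T. \<psi> (X a x)) / card ?B"
  proof -
    let ?W = "?B \<times> T"
    have cW: "real (card ?W) = card ?B * card T" by (simp add: card_cartesian_product)
    let ?\<mu> = "(\<Sum>(a, x)\<in>?W. X a x) / card ?W"
    have "real (\<Sum>a\<in>?B. \<Sum>x\<in>T. card {x' \<in> T. pattern I a x' = pattern I a x}) * 2 ^ card I
        \<le> card ?B * (card T * (2 ^ card I + card T))"
      using of_nat_mono[OF sum_card_pattern[OF I, of T], where 'a = real] cB by simp
    then have le: "(\<Sum>(a, x)\<in>?W. X a x) * 2 ^ card I \<le> card ?B * (card T * (2 ^ card I + card T))"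
      by (simp add: X_def sum.cartesian_product [symmetric])
    have "?\<mu> \<le> D"
      using le cBpos cT unfolding D cW by (simp add: divide_simps) (simp add: algebra_simps)
    moreover have "?\<mu> > 0"
      using finB Bne T Xpos by (intro divide_pos_pos sum_pos) (auto simp: card_gt_0_iff)
    ultimately have "\<psi> D \<le> \<psi> ?\<mu>"
      unfolding \<psi>_def using \<beta> by (intro ln_one_plus_div_antimono) auto
    also have "\<dots> \<le> (\<Sum>p\<in>?W. \<psi> ((\<lambda>(a, x). X a x) p)) / card ?W"
      unfolding \<psi>_def
      by (rule convex_on_avg[OF ln_one_plus_div_convex[OF \<beta>]]) (use finB Bne T Xpos in auto)
    also have "\<dots> = (\<Sum>(a, x)\<in>?W. \<psi> (X a x)) / card ?W"
      by (simp add: case_prod_beta)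
    finally show ?thesis
      using cT cBpos unfolding cW by (simp add: sum.cartesian_product field_simps)
  qed
  then have "s * (card T * \<psi> D) \<le> s * ((\<Sum>a\<in>?B. \<Sum>x\<in>T. \<psi> (X a x)) / card ?B)"
    using s by (rule mult_left_mono)
  also have "\<dots> = (\<Sum>a\<in>?B. s * (\<Sum>x\<in>T. \<psi> (X a x))) / card ?B"
    by (simp add: sum_distrib_left)
  finally have "exp (s * (card T * \<psi> D)) \<le> exp ((\<Sum>a\<in>?B. s * (\<Sum>x\<in>T. \<psi> (X a x))) / card ?B)"
    by simp
  also have "\<dots> \<le> (\<Sum>a\<in>?B. exp (s * (\<Sum>x\<in>T. \<psi> (X a x)))) / card ?B"
    using convex_on_avg[OF exp_convex finB Bne, of "\<lambda>a. s * (\<Sum>x\<in>T. \<psi> (X a x))"]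
    by simp
  finally have "exp (s * (card T * \<psi> D)) \<le> (\<Sum>a\<in>?B. exp (s * (\<Sum>x\<in>T. \<psi> (X a x)))) / card ?B" .
  moreover have "(1 + \<beta> * D) powr (s * card T / D) = exp (s * (card T * \<psi> D))"
    using \<beta> Dpos by (simp add: powr_def \<psi>_def add_pos_pos less_imp_neq[symmetric])
  ultimately show ?thesis by (simp add: logprod cB)
qed

section \<open>The potential\<close>

definition pattern_avg :: "'i set \<Rightarrow> real \<Rightarrow> (bit ^ 'u) set \<Rightarrow> ('i \<Rightarrow> bit ^ 'u) \<Rightarrow> (bit ^ 'u \<Rightarrow> bit ^ 'l) \<Rightarrow> real" where
  "pattern_avg I \<beta> S a h =
     (\<Sum>y\<in>UNIV. \<Prod>Z\<in>Pow I. 1 + \<beta> * card {x \<in> S. h x = y \<and> pattern I a x = Z}) / CARD(bit ^ 'l)"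

text \<open>Summing \<open>w\<close> over a label is the same as combining the \<open>w i\<close>
  with coefficients \<open>dot (a i) x\<close>, each 0 or 1. This keeps the twisted hash below
  within \<open>linear_maps\<close>.\<close>

lemma linear_pattern_sum:
  fixes w :: "'i \<Rightarrow> bit ^ 'l"
  assumes "finite I"
  shows "Vector_Spaces.linear (*s) (*s) (\<lambda>x. \<Sum>i\<in>pattern I a x. w i)"
proof -
  have eq: "(\<Sum>i\<in>pattern I a x. w i) = (\<Sum>i\<in>I. dot (a i) x *s w i)" for x
  proof -
    have "(\<Sum>i\<in>I. dot (a i) x *s w i) = (\<Sum>i\<in>I. if dot (a i) x = 1 then w i else 0)"
      by (intro sum.cong refl) auto
    also have "\<dots> = (\<Sum>i\<in>pattern I a x. w i)"
      using assms by (simp add: sum.inter_filter pattern_def)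
    finally show ?thesis ..
  qed
  show ?thesis
    unfolding eq
  proof (rule vec.linear_compose_sum[rule_format])
    fix i
    show "Vector_Spaces.linear (*s) (*s) (\<lambda>x. dot (a i) x *s w i)"
      unfolding Vector_Spaces.linear_iff
      by (intro conjI allI vec.vector_space_axioms)
        (simp_all only: dot_add_right dot_scale_right vec.scale_left_distrib vec.scale_scale)
  qed
qed

text \<open>For fixed \<open>w\<close> the twist permutes \<open>linear_maps\<close>, so the sum
  over \<open>h\<close> equals the average over \<open>w\<close> of the twisted sums. For fixed
  \<open>h\<close> the twist translates slice \<open>Z\<close> by the sum of \<open>w\<close> over
  \<open>Z\<close>, which is the setting of \<open>avg_shifted_prod_powr_le\<close>.\<close>

lemma sum_pattern_avg_powr_le:
  fixes S :: "(bit ^ 'u) set" and \<beta> :: real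
  assumes I: "finite I" and \<beta>: "\<beta> > 0"
  shows "(\<Sum>h\<in>linear_maps. pattern_avg I \<beta> S a (h :: bit ^ 'u \<Rightarrow> bit ^ 'l) powr (2 / 2 ^ card I))
    \<le> card (linear_maps :: (bit ^ 'u \<Rightarrow> bit ^ 'l) set) * (1 + \<beta> * card S / (real CARD(bit ^ 'l) * 2 ^ card I))\<^sup>2"
proof -
  let ?N = "real CARD(bit ^ 'l)" and ?s = "2 / 2 ^ card I :: real"
  let ?W = "I \<rightarrow>\<^sub>E (UNIV :: (bit ^ 'l) set)"
  let ?L = "linear_maps :: (bit ^ 'u \<Rightarrow> bit ^ 'l) set"
  have N: "?N > 0" by simp
  have pos: "1 + \<beta> * real k > 0" for k using \<beta> by (simp add: add_pos_nonneg)
  define twist where "twist w h = (\<lambda>x. h x - (\<Sum>i\<in>pattern I a x. w i))"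
    for w :: "'a \<Rightarrow> bit ^ 'l" and h :: "bit ^ 'u \<Rightarrow> bit ^ 'l"
  have shifted: "(\<Sum>w\<in>?W. pattern_avg I \<beta> S a (twist w h) powr ?s) / ?N ^ card I
      \<le> (1 + \<beta> * card S / (?N * 2 ^ card I))\<^sup>2" for h :: "bit ^ 'u \<Rightarrow> bit ^ 'l"
  proof -
    define g where "g Z y = 1 + \<beta> * real (card {x \<in> S. h x = y \<and> pattern I a x = Z})" for Z y
    have "pattern_avg I \<beta> S a (twist w h) = (\<Sum>y\<in>UNIV. \<Prod>Z\<in>Pow I. g Z (y + (\<Sum>i\<in>Z. w i))) / ?N" for w
    proof -
      have "{x \<in> S. twist w h x = y \<and> pattern I a x = Z} = {x \<in> S. h x = y + (\<Sum>i\<in>Z. w i) \<and> pattern I a x = Z}" for y Z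
        unfolding twist_def by (auto simp only: diff_eq_eq mem_Collect_eq)
      then show ?thesis by (simp add: pattern_avg_def g_def)
    qed
    then have "(\<Sum>w\<in>?W. pattern_avg I \<beta> S a (twist w h) powr ?s) / ?N ^ card I
        \<le> (\<Prod>Z\<in>Pow I. ((\<Sum>y\<in>UNIV. g Z y) / ?N) powr ?s)"
      using avg_shifted_prod_powr_le[of I g ?s] I pos by (simp add: g_def)
    also have "\<dots> = (\<Prod>Z\<in>Pow I. (1 + \<beta> * card {x \<in> S. pattern I a x = Z} / ?N) powr ?s)"
    proof (intro prod.cong refl)
      fix Z
      \<comment> \<open>Each point of a slice lies in exactly one bin, so the slice means no longer
        depend on \<open>h\<close>.\<close>
      have "(\<Sum>y\<in>UNIV. real (card {x \<in> S. h x = y \<and> pattern I a x = Z})) = card {x \<in> S. pattern I a x = Z}"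
        using sum.group[of "{x \<in> S. pattern I a x = Z}" UNIV h "\<lambda>_. 1 :: real"]
        by (simp add: conj_ac)
      then have "(\<Sum>y\<in>UNIV. g Z y) = ?N + \<beta> * card {x \<in> S. pattern I a x = Z}"
        by (simp add: g_def sum.distrib flip: sum_distrib_left)
      then show "((\<Sum>y\<in>UNIV. g Z y) / ?N) powr ?s = (1 + \<beta> * card {x \<in> S. pattern I a x = Z} / ?N) powr ?s"
        using N by (simp add: add_divide_distrib)
    qed
    \<comment> \<open>The exponent is twice that of a geometric mean; splitting off the square lets
      AM-GM apply with weights of total exactly 1.\<close>
    also have "\<dots> = (\<Prod>Z\<in>Pow I. (1 + \<beta> * card {x \<in> S. pattern I a x = Z} / ?N) powr (1 / 2 ^ card I))\<^sup>2"
      by (simp add: power2_eq_square flip: prod.distrib powr_add)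
    also have "\<dots> \<le> (1 / 2 ^ card I * (\<Sum>Z\<in>Pow I. 1 + \<beta> * card {x \<in> S. pattern I a x = Z} / ?N)
        + (1 - 1 / 2 ^ card I * card (Pow I)))\<^sup>2"
      using I \<beta> by (intro power_mono weighted_prod_powr_le prod_nonneg)
        (auto simp: card_Pow intro!: add_pos_nonneg)
    also have "(\<Sum>Z\<in>Pow I. 1 + \<beta> * card {x \<in> S. pattern I a x = Z} / ?N) = 2 ^ card I + \<beta> * card S / ?N"
    proof -
      have "pattern I a ` S \<subseteq> Pow I"
        by (intro image_subsetI pattern_in_Pow)
      then have "(\<Sum>Z\<in>Pow I. real (card {x \<in> S. pattern I a x = Z})) = card S"
        using sum.group[of S "Pow I" "pattern I a" "\<lambda>_. 1 :: real"] I by simp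
      then show ?thesis
        using I by (simp add: sum.distrib card_Pow flip: sum_distrib_left sum_divide_distrib)
    qed
    finally show ?thesis
      using I N by (simp add: card_Pow field_simps)
  qed
  have reindex: "(\<Sum>h\<in>?L. pattern_avg I \<beta> S a (twist w h) powr ?s) = (\<Sum>h\<in>?L. pattern_avg I \<beta> S a h powr ?s)" for w
  proof (rule sum.reindex_bij_witness[of _ "\<lambda>h x. h x + (\<Sum>i\<in>pattern I a x. w i)" "twist w"])
    fix h assume "h \<in> ?L"
    then have h: "Vector_Spaces.linear (*s) (*s) h" by (simp only: linear_maps_def mem_Collect_eq)
    show "twist w h \<in> ?L" and "(\<lambda>x. h x + (\<Sum>i\<in>pattern I a x. w i)) \<in> ?L"
      unfolding linear_maps_def twist_def mem_Collect_eq
      by (rule vec.linear_compose_sub[OF h linear_pattern_sum[OF I]],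
          rule vec.linear_compose_add[OF h linear_pattern_sum[OF I]])
  qed (auto simp: twist_def fun_eq_iff)
  have cW: "real (card ?W) = ?N ^ card I" using I by (simp add: card_PiE)
  have "?N ^ card I * (\<Sum>h\<in>?L. pattern_avg I \<beta> S a h powr ?s)
      = (\<Sum>w\<in>?W. \<Sum>h\<in>?L. pattern_avg I \<beta> S a (twist w h) powr ?s)"
    unfolding reindex using cW by simp
  also have "\<dots> = (\<Sum>h\<in>?L. \<Sum>w\<in>?W. pattern_avg I \<beta> S a (twist w h) powr ?s)"
    by (rule sum.swap)
  also have "\<dots> \<le> (\<Sum>h\<in>?L. ?N ^ card I * (1 + \<beta> * card S / (?N * 2 ^ card I))\<^sup>2)"
    using shifted N by (intro sum_mono) (simp add: divide_le_eq mult.commute)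
  finally have "?N ^ card I * (\<Sum>h\<in>?L. pattern_avg I \<beta> S a h powr ?s)
      \<le> ?N ^ card I * (card ?L * (1 + \<beta> * card S / (?N * 2 ^ card I))\<^sup>2)"
    by (simp add: algebra_simps)
  then show ?thesis
    using N by (subst (asm) mult_le_cancel_left_pos) auto
qed

text \<open>A Markov argument: if the maximal load is at least \<open>R\<close>, the heavy bin
  alone, as one term of the average over bins, forces the mean over \<open>a\<close> of the powered
  potential up to \<open>(1 + \<beta> * D) powr (2 - 2 / D)\<close> divided by
  \<open>CARD(bit ^ 'l) powr (2 / 2 ^ card I)\<close>.\<close>

lemma prob_max_load_ge_le:
  fixes S :: "(bit ^ 'u) set" and \<beta> R D :: real
  assumes I: "finite I" and \<beta>: "\<beta> > 0" and R: "R > 0"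
    and D: "D = 1 + R / 2 ^ card I"
  shows "measure_pmf.prob (pmf_of_set (linear_maps :: (bit ^ 'u \<Rightarrow> bit ^ 'l) set))
           {h. real (max_load S h) \<ge> R} * (1 + \<beta> * D) powr (2 - 2 / D)
    \<le> real CARD(bit ^ 'l) powr (2 / 2 ^ card I)
        * (1 + \<beta> * card S / (real CARD(bit ^ 'l) * 2 ^ card I))\<^sup>2"
proof -
  let ?N = "real CARD(bit ^ 'l)" and ?q = "2 ^ card I :: real"
  let ?s = "2 / ?q"
  let ?B = "I \<rightarrow>\<^sub>E (UNIV :: (bit ^ 'u) set)"
  let ?L = "linear_maps :: (bit ^ 'u \<Rightarrow> bit ^ 'l) set"
  let ?E = "?L \<inter> {h. real (max_load S h) \<ge> R}"
  let ?K = "(1 + \<beta> * card S / (?N * ?q))\<^sup>2"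
  have N: "?N > 0" by simp
  have cL: "real (card ?L) > 0"
    using finite_linear_maps linear_maps_nonempty by (simp add: card_gt_0_iff)
  have cB: "real (card ?B) = real CARD(bit ^ 'u) ^ card I" using I by (simp add: card_PiE)
  have finB: "finite ?B" using I by (simp add: finite_PiE)
  have cBpos: "real (card ?B) > 0" using finB by (simp add: card_gt_0_iff PiE_eq_empty_iff)
  have D1: "D > 1" using D R by simp
  have pos: "1 + \<beta> * real k > 0" for k using \<beta> by (simp add: add_pos_nonneg)
  have lower: "card ?B * ((1 + \<beta> * D) powr (2 - 2 / D) / ?N powr ?s)
      \<le> (\<Sum>a\<in>?B. pattern_avg I \<beta> S a h powr ?s)" if h: "h \<in> ?E" for h
  proof -
    have "max_load S h \<in> range (\<lambda>y. card (h -` {y} \<inter> S))"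
      unfolding max_load_def by (rule Max_in) auto
    then obtain y where y: "max_load S h = card (h -` {y} \<inter> S)" by auto
    define T where "T = h -` {y} \<inter> S"
    have RT: "R \<le> card T" using h y by (simp add: T_def)
    then have T: "T \<noteq> {}" using R by auto
    \<comment> \<open>The actual load may exceed \<open>R\<close>. Since
      \<open>card T = (D' - 1) * ?q\<close>, the exponent \<open>?s * card T / D'\<close> is
      \<open>2 - 2 / D'\<close>.\<close>
    define D' where "D' = 1 + card T / ?q"
    have DD: "D \<le> D'" using RT by (simp add: D D'_def divide_right_mono)
    have "D' > 0" using D1 DD by simp
    moreover have "card T = (D' - 1) * ?q" by (simp add: D'_def)
    ultimately have "?s * card T / D' = 2 - 2 / D'"
      by (simp only:) (simp add: field_simps)
    then have 1: "(1 + \<beta> * D') powr (2 - 2 / D') * card ?B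
        \<le> (\<Sum>a\<in>?B. (\<Prod>Z\<in>Pow I. 1 + \<beta> * card {x \<in> T. pattern I a x = Z}) powr ?s)"
      using avg_pattern_prod_powr_ge[OF I T \<beta>, of ?s D'] cB cBpos
      by (simp add: D'_def pos_le_divide_eq)
    have 2: "(\<Prod>Z\<in>Pow I. 1 + \<beta> * card {x \<in> T. pattern I a x = Z}) powr ?s
        \<le> ?N powr ?s * pattern_avg I \<beta> S a h powr ?s" for a
    proof -
      have "(\<Prod>Z\<in>Pow I. 1 + \<beta> * card {x \<in> T. pattern I a x = Z})
          = (\<Prod>Z\<in>Pow I. 1 + \<beta> * card {x \<in> S. h x = y \<and> pattern I a x = Z})"
        by (intro prod.cong arg_cong[where f = "\<lambda>A. 1 + \<beta> * real (card A)"]) (auto simp: T_def)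
      also have "\<dots> \<le> (\<Sum>y\<in>UNIV. \<Prod>Z\<in>Pow I. 1 + \<beta> * card {x \<in> S. h x = y \<and> pattern I a x = Z})"
        using pos by (intro member_le_sum prod_nonneg) (auto simp: less_imp_le)
      also have "\<dots> = ?N * pattern_avg I \<beta> S a h"
        using N by (simp add: pattern_avg_def)
      finally have "(\<Prod>Z\<in>Pow I. 1 + \<beta> * card {x \<in> T. pattern I a x = Z}) powr ?s
          \<le> (?N * pattern_avg I \<beta> S a h) powr ?s"
        using pos by (intro powr_mono2 prod_nonneg) (auto simp: less_imp_le)
      then show ?thesis by (simp only: powr_mult)
    qed
    \<comment> \<open>The base, which is at least 1, and the exponent both grow with
      \<open>D\<close>, so \<open>D'\<close> may be lowered to \<open>D\<close>.\<close>
    have "(1 + \<beta> * D) powr (2 - 2 / D) \<le> (1 + \<beta> * D') powr (2 - 2 / D)"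
      using \<beta> D1 DD by (intro powr_mono2) (auto simp: divide_le_eq)
    also have "\<dots> \<le> (1 + \<beta> * D') powr (2 - 2 / D')"
      using \<beta> D1 DD by (intro powr_mono) (auto simp: frac_le)
    finally have "card ?B * (1 + \<beta> * D) powr (2 - 2 / D) \<le> (1 + \<beta> * D') powr (2 - 2 / D') * card ?B"
      using cBpos by simp
    also note 1
    also have "(\<Sum>a\<in>?B. (\<Prod>Z\<in>Pow I. 1 + \<beta> * card {x \<in> T. pattern I a x = Z}) powr ?s)
        \<le> (\<Sum>a\<in>?B. ?N powr ?s * pattern_avg I \<beta> S a h powr ?s)"
      by (intro sum_mono 2)
    finally show ?thesis
      unfolding sum_distrib_left [symmetric] using N by (simp add: divide_le_eq mult.commute)
  qed
  have "card ?E * (card ?B * ((1 + \<beta> * D) powr (2 - 2 / D) / ?N powr ?s))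
      = (\<Sum>h\<in>?E. card ?B * ((1 + \<beta> * D) powr (2 - 2 / D) / ?N powr ?s))"
    by (rule sum_constant [symmetric])
  also have "\<dots> \<le> (\<Sum>h\<in>?E. \<Sum>a\<in>?B. pattern_avg I \<beta> S a h powr ?s)"
    by (intro sum_mono lower)
  also have "\<dots> \<le> (\<Sum>h\<in>?L. \<Sum>a\<in>?B. pattern_avg I \<beta> S a h powr ?s)"
    using finite_linear_maps by (intro sum_mono2 sum_nonneg) auto
  also have "\<dots> = (\<Sum>a\<in>?B. \<Sum>h\<in>?L. pattern_avg I \<beta> S a h powr ?s)"
    by (rule sum.swap)
  also have "\<dots> \<le> (\<Sum>a\<in>?B. card ?L * ?K)"
    by (intro sum_mono sum_pattern_avg_powr_le I \<beta>)
  also have "\<dots> = card ?B * (card ?L * ?K)"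
    by simp
  finally have "card ?B * (card ?E * ((1 + \<beta> * D) powr (2 - 2 / D) / ?N powr ?s)) \<le> card ?B * (card ?L * ?K)"
    by (simp only: mult.left_commute)
  then have "card ?E * ((1 + \<beta> * D) powr (2 - 2 / D) / ?N powr ?s) \<le> card ?L * ?K"
    using cBpos by (subst (asm) mult_le_cancel_left_pos)
  then have "card ?E / card ?L * (1 + \<beta> * D) powr (2 - 2 / D) \<le> ?N powr ?s * ?K"
    using cL N by (simp add: field_simps)
  moreover have "measure_pmf.prob (pmf_of_set ?L) {h. real (max_load S h) \<ge> R} = card ?E / card ?L"
    by (rule measure_pmf_of_set[OF linear_maps_nonempty finite_linear_maps])
  ultimately show ?thesis by simp
qed

section \<open>Numerical estimates\<close>

text \<open>The value 11/20 separates the sides, roughly 0.541 and 0.560. The 7/4 later becomes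
  \<open>7 = 4 * (7 / 4)\<close> and, squared, the constant 49.\<close>

lemma ln_7_4_ge: "4 / (exp 1)\<^sup>2 \<le> ln (7 / 4 :: real)"
proof -
  have "exp 1 \<ge> (27 / 10 :: real)"
    using e_approx_32 unfolding abs_le_iff by (simp add: power_divide field_simps)
  then have "(27 / 10)\<^sup>2 \<le> (exp 1 :: real)\<^sup>2"
    by (intro power_mono) auto
  then have "4 / (exp 1)\<^sup>2 \<le> (11 / 20 :: real)"
    by (simp add: divide_le_eq power2_eq_square)
  also have "exp (11 :: real) = exp 1 ^ 11"
    by (simp flip: exp_of_nat_mult)
  then have "exp (11 :: real) \<le> (7 / 4) ^ 20"
    using power_mono[of "exp 1" "272 / 100 :: real" 11] e_less_272 by (simp add: power_divide)
  then have "(11 :: real) \<le> ln ((7 / 4) ^ 20)"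
    by (subst ln_ge_iff) auto
  then have "(11 / 20 :: real) \<le> ln (7 / 4)"
    by (simp add: ln_realpow del: ln_div)
  finally show ?thesis .
qed

text \<open>The tangent to \<open>ln\<close> at \<open>e^2\<close> gives
  \<open>4 * ln y / y <= 4 / e^2 + 4 / y\<close>, hence
  \<open>y powr (4 / y) <= 7 / 4 * exp (4 / y)\<close>. The factor \<open>exp (4 / y)\<close> is
  absorbed by \<open>1 - 4 / y\<close>, which dominates \<open>(r - 2) / y\<close> because
  \<open>y >= r + 2\<close>; this is the origin of the offset 2.\<close>

lemma tail_base_le:
  fixes a r y :: real
  assumes a: "1 / 4 \<le> a" and r: "r \<ge> 6" and y: "y = r + 1 / a" and "a \<le> 1 / 2"
  shows "4 * y powr (1 / (a * y) - 1) * (r - 2) \<le> 7"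
proof -
  have apos: "a > 0" using a by simp
  have "1 / a \<ge> 2" using assms(4) apos by (simp add: le_divide_eq)
  then have y1: "y \<ge> r + 2" using y by simp
  then have ypos: "y > 0" "y \<ge> 8" using r by auto
  have "ln y \<le> y / (exp 1)\<^sup>2 + 1"
    using ln_le_minus_one[of "y / (exp 1)\<^sup>2"] ypos by (simp add: ln_div ln_realpow)
  then have "4 * (ln y - 1) \<le> 4 * (y / (exp 1)\<^sup>2)"
    by (intro mult_left_mono) (simp_all only: diff_le_eq zero_le_numeral)
  also have "\<dots> = y * (4 / (exp 1)\<^sup>2)" by simp
  also have "\<dots> \<le> y * ln (7 / 4)"
    using ln_7_4_ge ypos by (intro mult_left_mono) auto
  finally have 1: "4 * (ln y - 1) \<le> y * ln (7 / 4)" .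
  have 2: "4 * ln y / y \<le> ln (7 / 4) + 4 / y"
  proof -
    have "(ln (7 / 4) + 4 / y) * y = y * ln (7 / 4) + 4" using ypos by (simp add: distrib_right)
    then show ?thesis using ypos 1 by (simp only: pos_divide_le_eq) simp
  qed
  have "1 / (a * y) \<le> 4 / y"
    using a apos ypos by (simp add: field_simps)
  then have "1 / (a * y) * ln y \<le> 4 / y * ln y"
    using ypos by (intro mult_right_mono) auto
  with 2 have "1 / (a * y) * ln y \<le> ln (7 / 4) + 4 / y" by simp
  then have "exp (1 / (a * y) * ln y) \<le> exp (ln (7 / 4) + 4 / y)"
    by (simp only: exp_le_cancel_iff)
  also have "\<dots> = 7 / 4 * exp (4 / y)"
    by (subst exp_add) simp
  finally have "y powr (1 / (a * y)) \<le> 7 / 4 * exp (4 / y)"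
    using ypos by (simp add: powr_def)
  moreover have "(1 - 4 / y) * exp (4 / y) \<le> 1"
    using exp_ge_add_one_self[of "- (4 / y)"] by (simp add: exp_minus field_simps)
  moreover have "(r - 2) / y \<le> 1 - 4 / y"
    using y1 ypos divide_right_mono[of "r - 2" "y - 4" y] by (simp add: diff_divide_distrib)
  ultimately have "y powr (1 / (a * y)) * ((r - 2) / y) \<le> 7 / 4 * exp (4 / y) * (1 - 4 / y)"
    using r ypos by (intro mult_mono) auto
  also have "\<dots> \<le> 7 / 4" 
    using \<open>(1 - 4 / y) * exp (4 / y) \<le> 1\<close> by (simp add: mult.commute)
  finally show ?thesis
    using ypos by (simp add: powr_diff mult_ac)
qed

text \<open>Equivalently \<open>k ^ 3 <= 16 * 2 powr k\<close>. The tangent to \<open>ln\<close> at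
  5 works because its tripled slope 3/5 is below \<open>ln 2\<close> and because
  \<open>5 ^ 2 <= 2 ^ 5\<close>.\<close>

lemma three_ln_le:
  fixes k :: real
  assumes "k > 0"
  shows "3 * ln k \<le> 4 * ln 2 + k * ln 2"
proof -
  have "ln k \<le> k / 5 + ln 5 - 1"
    using ln_le_minus_one[of "k / 5"] assms by (simp add: ln_div)
  moreover have "2 * ln 5 \<le> 5 * ln (2 :: real)"
  proof -
    have "ln ((5 :: real) ^ 2) \<le> ln (2 ^ 5)" by (subst ln_le_cancel_iff) auto
    then show ?thesis by (simp only: ln_realpow zero_less_numeral of_nat_numeral)
  qed
  moreover have "k * (3 / 5) \<le> k * ln 2"
    using assms ln2_ge_two_thirds by (intro mult_left_mono) auto
  moreover have "ln (2 :: real) \<le> 6 / 7"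
    using ln2_le_25_over_36 by simp
  ultimately show ?thesis by linarith
qed

text \<open>For \<open>a = opt m n / q\<close> the second part weighs the loss
  \<open>n powr (1 / q)\<close> against the gain from a large base. In the sparse case, with
  \<open>\<rho> = l * n / m\<close> and \<open>\<kappa> = log 2 \<rho>\<close>, the loss is
  \<open>\<rho> powr a\<close>, the base is \<open>\<rho> / \<kappa>\<close> and the exponent at
  most \<open>- 3 * a / 2\<close>, so the product is at most
  \<open>(\<kappa> ^ 3 / \<rho>) powr (a / 2) <= 16 powr (a / 2) <= 2\<close>. In the dense case the
  base is 1 and the loss alone is at most 2.\<close>

lemma opt_bounds:
  fixes m l n :: nat
  assumes l: "l \<ge> 1" and m: "m \<ge> 1" and n: "n = 2 ^ l"
  shows opt_ge_half: "opt m n \<ge> 1 / 2"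
    and opt_balance: "\<And>a D. 1 / 4 \<le> a \<Longrightarrow> a \<le> 1 / 2 \<Longrightarrow> 1 + 6 * a \<le> D \<Longrightarrow>
      real n powr (a / opt m n) * (opt m n * n / m) powr (1 / D - 1) \<le> 2"
proof -
  define t where "t = real m / n"
  have npos: "real n > 0" using n by simp
  have t: "t > 0" using m npos by (simp add: t_def)
  have lg: "log 2 (real n) = l" using n by (simp add: log_nat_power)
  have cond: "real m \<le> 1 / 2 * real n * log 2 (real n) \<longleftrightarrow> t \<le> l / 2"
    using npos by (simp add: t_def lg field_simps)
  have lnn: "ln (real n) = l * ln 2" using n by (simp add: ln_realpow)
  have "opt m n \<ge> 1 / 2 \<and> (\<forall>a D. 1 / 4 \<le> a \<longrightarrow> a \<le> 1 / 2 \<longrightarrow> 1 + 6 * a \<le> D \<longrightarrow>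
      real n powr (a / opt m n) * (opt m n / t) powr (1 / D - 1) \<le> 2)"
  proof (cases "t \<le> l / 2")
    case True
    define \<rho> where "\<rho> = l / t"
    define \<kappa> where "\<kappa> = log 2 \<rho>"
    have \<rho>: "\<rho> \<ge> 2" using True t by (simp add: \<rho>_def field_simps)
    have \<kappa>: "\<kappa> \<ge> 1" using \<rho> by (simp add: \<kappa>_def)
    have ln\<rho>: "ln \<rho> = \<kappa> * ln 2" using \<rho> by (simp add: \<kappa>_def log_def)
    have opt: "opt m n = l / \<kappa>"
      using True cond by (simp add: opt_def lg \<kappa>_def \<rho>_def t_def mult.commute)
    \<comment> \<open>From \<open>m >= 1\<close> follows \<open>\<rho> <= 4 ^ l\<close>, so
      \<open>\<kappa> <= 2 * l\<close>, which is the lower bound 1/2 for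
      \<open>l / \<kappa>\<close>.\<close>
    have "\<rho> \<le> real l * 2 ^ l"
    proof -
      have "\<rho> = l * (n / m)" by (simp add: \<rho>_def t_def)
      also have "\<dots> \<le> real l * real n" using m npos by (intro mult_left_mono) (auto simp: divide_le_eq)
      finally show ?thesis by (simp add: n)
    qed
    also have "real l * 2 ^ l \<le> 2 ^ l * 2 ^ l"
      using of_nat_less_two_power[of l, where 'a = real] by (intro mult_right_mono) auto
    also have "\<dots> = 2 powr (2 * l)" using powr_realpow[of 2 "2 * l"] by (simp flip: power_add mult_2)
    finally have \<kappa>2: "\<kappa> \<le> 2 * l"
      using \<rho> by (simp add: \<kappa>_def log_le_iff)
    have half: "opt m n \<ge> 1 / 2" using \<kappa> \<kappa>2 by (simp add: opt le_divide_eq)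
    have ratio: "opt m n / t = \<rho> / \<kappa>" by (simp add: opt \<rho>_def)
    \<comment> \<open>The base \<open>\<rho> / \<kappa>\<close> is at least 1, so an upper bound on
      the exponent may be inserted.\<close>
    have "ln \<kappa> \<le> ln \<rho>"
    proof -
      have "\<kappa> \<le> \<rho>"
      proof -
        have "\<kappa> * (2 / 3) \<le> \<kappa> * ln 2" using \<kappa> ln2_ge_two_thirds by (intro mult_left_mono) auto
        moreover have "ln \<rho> - ln 2 \<le> \<rho> / 2 - 1"
          using ln_le_minus_one[of "\<rho> / 2"] \<rho> by (simp add: ln_div)
        ultimately show ?thesis using ln\<rho> ln2_le_25_over_36 \<rho> by linarith
      qed
      then show ?thesis using \<kappa> \<rho> by simp
    qed
    have "real n powr (a / opt m n) * (opt m n / t) powr (1 / D - 1) \<le> 2"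
      if a: "1 / 4 \<le> a" "a \<le> 1 / 2" and D: "1 + 6 * a \<le> D" for a D
    proof -
      have "1 / D \<le> 1 / (1 + 6 * a)" using a D by (intro divide_left_mono) auto
      \<comment> \<open>The right side is the chord of the convex function
        \<open>1 / (1 + 6 * a)\<close> over the interval from 0 to 1/2.\<close>
      also have "\<dots> \<le> 1 - 3 * a / 2"
      proof -
        have "0 \<le> (9 * a) * (1 / 2 - a)" using a by (intro mult_nonneg_nonneg) auto
        then have "1 \<le> (1 - 3 * a / 2) * (1 + 6 * a)" by (simp add: algebra_simps)
        then show ?thesis using a by (simp only: pos_divide_le_eq)
      qed
      finally have *: "(1 / D - 1) * (ln \<rho> - ln \<kappa>) \<le> - (3 * a / 2) * (ln \<rho> - ln \<kappa>)"
        using \<open>ln \<kappa> \<le> ln \<rho>\<close> by (intro mult_right_mono) auto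
      have "a * \<kappa> * ln 2 + (1 / D - 1) * (ln \<rho> - ln \<kappa>) \<le> a / 2 * (3 * ln \<kappa> - ln \<rho>)"
      proof -
        have "a * \<kappa> * ln 2 = a * ln \<rho>" by (simp add: ln\<rho>)
        moreover have "a * ln \<rho> + - (3 * a / 2) * (ln \<rho> - ln \<kappa>) = a / 2 * (3 * ln \<kappa> - ln \<rho>)"
          by (simp add: field_simps)
        ultimately show ?thesis using * by linarith
      qed
      also have "\<dots> \<le> a / 2 * (4 * ln 2)"
        using three_ln_le[of \<kappa>] \<kappa> a unfolding ln\<rho> by (intro mult_left_mono) auto
      also have "\<dots> \<le> ln 2" using a by simp
      finally have "exp (a * \<kappa> * ln 2 + (1 / D - 1) * (ln \<rho> - ln \<kappa>)) \<le> exp (ln 2)"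
        by (simp only: exp_le_cancel_iff)
      moreover have "real n powr (a / opt m n) = exp (a * \<kappa> * ln 2)"
        using npos l by (simp add: powr_def lnn opt)
      moreover have "(\<rho> / \<kappa>) powr (1 / D - 1) = exp ((1 / D - 1) * (ln \<rho> - ln \<kappa>))"
        using \<rho> \<kappa> by (simp add: powr_def ln_div)
      ultimately show ?thesis by (simp add: ratio exp_add)
    qed
    with half show ?thesis by blast
  next
    case False
    then have opt: "opt m n = t" using cond by (simp add: opt_def t_def)
    have "real n powr (a / t) \<le> 2" if "1 / 4 \<le> a" "a \<le> 1 / 2" for a
    proof -
      have "a * l \<le> 1 / 2 * l" using that by (intro mult_right_mono) auto
      then have "a / t * l \<le> 1"
        using False t by (simp add: divide_le_eq)
      then have "a / t * l * ln 2 \<le> 1 * ln 2" by (intro mult_right_mono) auto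
      then have "exp (a / t * l * ln 2) \<le> exp (ln 2)" by (simp only: exp_le_cancel_iff mult_1)
      then show ?thesis using npos by (simp add: powr_def lnn mult.assoc)
    qed
    moreover have "t \<ge> 1 / 2" using False l by simp
    ultimately show ?thesis using t by (simp add: opt)
  qed
  then show "opt m n \<ge> 1 / 2"
    and "\<And>a D. 1 / 4 \<le> a \<Longrightarrow> a \<le> 1 / 2 \<Longrightarrow> 1 + 6 * a \<le> D \<Longrightarrow>
      real n powr (a / opt m n) * (opt m n * n / m) powr (1 / D - 1) \<le> 2"
    by (auto simp: t_def)
qed

text \<open>The interval spans a factor of two, hence contains a power of two;
  \<open>x >= 1 / 2\<close> makes the floor nonnegative, so \<open>nat\<close> loses
  nothing.\<close>

lemma ex_power_two_between:
  fixes x :: real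
  assumes "x \<ge> 1 / 2"
  shows "\<exists>j::nat. 2 * x \<le> 2 ^ j \<and> 2 ^ j \<le> 4 * x"
proof -
  define j where "j = nat \<lfloor>log 2 (4 * x)\<rfloor>"
  have "log 2 (4 * x) \<ge> 1" using assms by simp
  then have j: "real j = of_int \<lfloor>log 2 (4 * x)\<rfloor>" by (simp add: j_def)
  have "2 powr real j \<le> 2 powr log 2 (4 * x)"
    using j by (intro powr_mono) auto
  moreover have "2 powr log 2 (4 * x) \<le> 2 powr (1 + real j)"
    using j by (intro powr_mono) linarith+
  ultimately show ?thesis
    using assms by (intro exI[of _ j]) (simp add: powr_add powr_realpow)
qed

lemma CARD_bit: "CARD(bit) = 2"
proof -
  have "(UNIV :: bit set) = {0, 1}" by (auto intro: bit.exhaust)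
  then have "CARD(bit) = card {0 :: bit, 1}" by (rule arg_cong)
  also have "\<dots> = 2" by simp
  finally show ?thesis .
qed

section \<open>Choice of parameters and the tail bound\<close>

theorem theorem1p3:
  fixes S :: "(bit ^ 'u) set" and m n :: nat and r :: real
  assumes "CARD('u) \<ge> CARD('l)" and "CARD('l) \<ge> 1" and "m \<ge> 1"
    and "n = 2 ^ CARD('l)"
    and "card S = m"
    and "r \<ge> 6"
  shows "measure_pmf.prob
           (pmf_of_set (linear_maps :: (bit ^ 'u \<Rightarrow> bit ^ 'l) set))
           {h. real (max_load S h) \<ge> r * opt m n}
         \<le> 49 / (r - 2)\<^sup>2"
proof -
  let ?P = "measure_pmf.prob (pmf_of_set (linear_maps :: (bit ^ 'u \<Rightarrow> bit ^ 'l) set))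
           {h. real (max_load S h) \<ge> r * opt m n}"
  define x where "x = opt m n"
  have x: "x \<ge> 1 / 2" unfolding x_def by (rule opt_ge_half[OF assms(2,3,4)])
  obtain j :: nat where j: "2 * x \<le> 2 ^ j" "2 ^ j \<le> 4 * x"
    using ex_power_two_between[OF x] by blast
  define q :: real where "q = 2 ^ j"
  \<comment> \<open>Rounding \<open>q\<close> to a power of two leaves \<open>a\<close> between 1/4
    and 1/2, and \<open>y\<close> is chosen so that \<open>D = a * y\<close>. The choice of
    \<open>\<beta>\<close> makes the base \<open>1 + \<beta> * m / (n * q)\<close> of the upper
    bound equal to 2.\<close>
  define a where "a = x / q"
  define y where "y = r + 1 / a"
  define D where "D = 1 + r * x / q"
  define \<beta> where "\<beta> = q * n / m"
  have q: "q > 0" by (simp add: q_def)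
  have npos: "real n > 0" "real m > 0" using assms by auto
  have a: "1 / 4 \<le> a" "a \<le> 1 / 2" using j q x by (simp_all add: a_def q_def field_simps)
  have D_eq: "D = a * y" using x q by (simp add: D_def a_def y_def field_simps)
  have "6 * a \<le> r * a" using assms(6) a by (intro mult_right_mono) auto
  then have D6: "1 + 6 * a \<le> D" by (simp add: D_def a_def)
  then have D1: "D > 1" using a by simp
  have \<beta>: "\<beta> > 0" using q npos by (simp add: \<beta>_def)
  \<comment> \<open>This factorisation separates the two numerical estimates:
    \<open>x * n / m\<close> goes to \<open>opt_balance\<close>, \<open>y\<close> to
    \<open>tail_base_le\<close>.\<close>
  have \<beta>D: "\<beta> * D = (x * n / m) * y" using q by (simp add: \<beta>_def D_eq a_def)
  have cN: "CARD(bit ^ 'l) = n" using assms(4) by (simp add: CARD_bit)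
  have "?P * (1 + \<beta> * D) powr (2 - 2 / D) \<le> real n powr (2 / q) * (1 + \<beta> * m / (n * q))\<^sup>2"
    using prob_max_load_ge_le[of "{..<j}" \<beta> "r * opt m n" D S, where 'l = 'l] \<beta> assms(5,6) x
    by (simp only: cN) (simp add: D_def q_def x_def)
  also have "1 + \<beta> * m / (n * q) = 2" using npos q by (simp add: \<beta>_def)
  finally have 1: "?P * (1 + \<beta> * D) powr (2 - 2 / D) \<le> real n powr (2 / q) * 4" by simp
  have "?P * (\<beta> * D) powr (2 - 2 / D) \<le> ?P * (1 + \<beta> * D) powr (2 - 2 / D)"
    using \<beta> D1 by (intro mult_left_mono powr_mono2) (auto simp: divide_le_eq)
  with 1 have "?P * (\<beta> * D) powr (2 - 2 / D) \<le> real n powr (2 / q) * 4" by linarith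
  then have "?P * (\<beta> * D) powr (2 - 2 / D) * (\<beta> * D) powr (2 / D - 2)
      \<le> real n powr (2 / q) * 4 * (\<beta> * D) powr (2 / D - 2)"
    by (intro mult_right_mono) auto
  moreover have "(\<beta> * D) powr (2 - 2 / D) * (\<beta> * D) powr (2 / D - 2) = 1"
    using \<beta> D1 by (simp flip: powr_add)
  ultimately have "?P \<le> real n powr (2 / q) * 4 * (\<beta> * D) powr (2 / D - 2)"
    by (simp only: mult.assoc mult_1_right)
  \<comment> \<open>The whole bound is a perfect square, so it suffices to bound its root by
    \<open>7 / (r - 2)\<close>.\<close>
  also have "\<dots> = (2 * real n powr (1 / q) * (\<beta> * D) powr (1 / D - 1))\<^sup>2"
    by (simp add: power2_eq_square algebra_simps flip: powr_add)
  also have "\<dots> \<le> (7 / (r - 2))\<^sup>2"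
  proof (rule power_mono)
    have "real n powr (1 / q) * (x * n / m) powr (1 / D - 1) \<le> 2"
      using opt_balance[OF assms(2,3,4) a D6] x by (simp add: a_def x_def)
    then have "2 * (real n powr (1 / q) * (x * n / m) powr (1 / D - 1)) * y powr (1 / D - 1)
        \<le> 4 * y powr (1 / D - 1)"
      by (intro mult_right_mono) auto
    also have "\<dots> \<le> 7 / (r - 2)"
      using tail_base_le[OF a(1) assms(6) y_def a(2)] assms(6) by (simp add: D_eq pos_le_divide_eq)
    finally show "2 * real n powr (1 / q) * (\<beta> * D) powr (1 / D - 1) \<le> 7 / (r - 2)"
      by (simp only: \<beta>D powr_mult mult.assoc)
  qed simp
  finally show ?thesis by (simp add: power_divide)
qed

end
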